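(* There exists a linear functional $\mathcal F:l_\infty\to\mathbb R$ satisfying the following: (i) $\|\mathcal F\|=1$; (ii) $\mathcal F|_{st}=g$, where $g:st\to\mathbb R$, $g(x)=\mathrm{stat}\lim_{n\to\infty}x_n$, is the statistical limit functional on $st$; (iii) if $s\in l_\infty$ with $s_n\ge 0$ a.a.$n$, then $\mathcal F(s)\ge 0$; (iv) if $x\in l_\infty$, then $\mathcal F(x)=\mathcal F(Tx)$ for every map $T:l_\infty\to l_\infty$ such that, for each $y\in l_\infty$, $(Ty)_k=(Sy)_k$ a.a.$k$, where $S$ is the shift operator $S((x_n)_{n=1}^\infty)=(x_n)_{n=2}^\infty$.
   Context: $l_\infty$ is the normed linear space of all bounded real sequences $x=(x_n)_{n\in\mathbb N}$, $\mathbb N=\{1,2,3,\dots\}$, with the norm $\|x\|_\infty=\sup_n|x_n|$; $\|\mathcal F\|$ is the operator norm of a linear functional. For $P\subset\mathbb N$, the natural density is $\delta(P)=\lim_{n\to\infty}\frac{|P\cap\{1,\dots,n\}|}{n}$ when the limit exists. A condition is satisfied by $x_k$ "a.a.$k$" (for almost all $k$) if the set $E$ of those $k\in\mathbb N$ for which $x_k$ does not satisfy it has $\delta(E)=0$. A real sequence $(p_k)$ converges statistically to $\ell\in\mathbb R$, written $\mathrm{stat}\lim_{n\to\infty} p_n=\ell$, if for every $\epsilon>0$, $\delta(\{k\in\mathbb N:|p_k-\ell|>\epsilon\})=0$. $st\subset l_\infty$ is the subspace of all bounded statistically convergent real sequences. *)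

theory Defs
  imports "HOL-Analysis.Analysis"
begin

(* Since nat carries the discrete topology, every bounded sequence is a bounded continuous
   function, and the norm of this type is the supremum norm. *)
type_synonym linf = "nat \<Rightarrow>\<^sub>C real"

(* Sequences are indexed by 1, 2, 3, ...: the k-th term (k \<ge> 1) is stored at argument k - 1.
   The value of seq_term x at k = 0 is junk; all notions below only look at indices k \<ge> 1. *)
definition seq_term :: "linf \<Rightarrow> nat \<Rightarrow> real" where
  "seq_term x k = apply_bcontfun x (k - 1)"

(* The natural density of P exists and equals d, where P is read as a subset of {1, 2, 3, ...}. *)
definition has_natural_density :: "nat set \<Rightarrow> real \<Rightarrow> bool" where
  "has_natural_density P d \<longleftrightarrow> (\<lambda>n. real (card (P \<inter> {1..n})) / real n) \<longlonglongrightarrow> d"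

definition almost_all :: "(nat \<Rightarrow> bool) \<Rightarrow> bool" where
  "almost_all Q \<longleftrightarrow> has_natural_density {k. 1 \<le> k \<and> \<not> Q k} 0"

definition stat_converges_to :: "(nat \<Rightarrow> real) \<Rightarrow> real \<Rightarrow> bool" where
  "stat_converges_to p l \<longleftrightarrow>
     (\<forall>\<epsilon>>0. has_natural_density {k. 1 \<le> k \<and> \<bar>p k - l\<bar> > \<epsilon>} 0)"

definition st :: "linf set" where
  "st = {x. \<exists>l. stat_converges_to (seq_term x) l}"

definition stat_lim :: "linf \<Rightarrow> real" where
  "stat_lim x = (THE l. stat_converges_to (seq_term x) l)"

definition shift :: "linf \<Rightarrow> linf" where
  "shift x = Bcontfun (\<lambda>i. apply_bcontfun x (Suc i))"

lemma norm_linf: "norm (x :: linf) = (SUP k\<in>{1..}. \<bar>seq_term x k\<bar>)"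
proof -
  have "range (apply_bcontfun x) = seq_term x ` {1..}"
  proof (intro equalityI subsetI)
    fix r assume "r \<in> range (apply_bcontfun x)"
    then obtain i where "r = apply_bcontfun x i" by auto
    then have "r = seq_term x (Suc i)" by (simp add: seq_term_def)
    then show "r \<in> seq_term x ` {1..}" by auto
  qed (auto simp: seq_term_def)
  then have "range (\<lambda>i. \<bar>apply_bcontfun x i\<bar>) = (\<lambda>k. \<bar>seq_term x k\<bar>) ` {1..}"
    by (metis image_image)
  moreover have "norm x = (SUP i. \<bar>apply_bcontfun x i\<bar>)"
    by (simp add: norm_bcontfun_def dist_bcontfun_def)
  ultimately show ?thesis by simp
qed

lemma seq_term_shift:
  assumes "1 \<le> k"
  shows "seq_term (shift x) k = seq_term x (k + 1)"
proof -
  have "bounded (range (\<lambda>i. apply_bcontfun x (Suc i)))"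
    by (rule bounded_subset[OF bounded_apply_bcontfun]) auto
  then have "(\<lambda>i. apply_bcontfun x (Suc i)) \<in> bcontfun"
    by (simp add: bcontfun_def)
  then show ?thesis
    using assms by (simp add: seq_term_def shift_def Bcontfun_inverse)
qed

lemma stat_converges_to_unique:
  assumes "stat_converges_to p l" "stat_converges_to p m"
  shows "l = m"
proof (rule ccontr)
  assume "l \<noteq> m"
  define e where "e = \<bar>l - m\<bar> / 3"
  have e: "e > 0" using \<open>l \<noteq> m\<close> by (simp add: e_def)
  define A where "A = {k. 1 \<le> k \<and> \<bar>p k - l\<bar> > e}"
  define B where "B = {k. 1 \<le> k \<and> \<bar>p k - m\<bar> > e}"
  have "(\<lambda>n. real (card (A \<inter> {1..n})) / real n + real (card (B \<inter> {1..n})) / real n)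
          \<longlonglongrightarrow> 0 + 0"
    using assms e unfolding A_def B_def stat_converges_to_def has_natural_density_def
    by (intro tendsto_add) auto
  then have "eventually (\<lambda>n. real (card (A \<inter> {1..n})) / real n
                 + real (card (B \<inter> {1..n})) / real n < 1) sequentially"
    by (rule order_tendstoD) simp
  then obtain N where N: "\<And>n. n \<ge> N \<Longrightarrow> real (card (A \<inter> {1..n})) / real n
                 + real (card (B \<inter> {1..n})) / real n < 1"
    by (auto simp: eventually_sequentially)
  define n where "n = Suc N"
  have cover: "{1..n} \<subseteq> (A \<inter> {1..n}) \<union> (B \<inter> {1..n})"
  proof
    fix k assume k: "k \<in> {1..n}"
    have "\<bar>p k - l\<bar> > e \<or> \<bar>p k - m\<bar> > e"
      using e by (auto simp: e_def abs_if split: if_splits)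
    then show "k \<in> (A \<inter> {1..n}) \<union> (B \<inter> {1..n})"
      using k by (auto simp: A_def B_def)
  qed
  have "n \<le> card ((A \<inter> {1..n}) \<union> (B \<inter> {1..n}))"
    using card_mono[OF _ cover] by simp
  also have "\<dots> \<le> card (A \<inter> {1..n}) + card (B \<inter> {1..n})"
    by (rule card_Un_le)
  finally have "real n \<le> real (card (A \<inter> {1..n})) + real (card (B \<inter> {1..n}))"
    by linarith
  moreover have "real (card (A \<inter> {1..n})) + real (card (B \<inter> {1..n})) < real n"
    using N[of n] by (simp add: n_def add_divide_distrib[symmetric] divide_simps)
  ultimately show False by linarith
qed

lemma stat_lim_eqI: "stat_converges_to (seq_term x) l \<Longrightarrow> stat_lim x = l"
  unfolding stat_lim_def by (blast intro: the_equality stat_converges_to_unique)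

end

theory Submission
  imports Defs
begin

text \<open>
  The functional is a generalised limit of the Cesaro means
  \<open>(x\<^sub>1 + \<dots> + x\<^sub>n) / n\<close>. The means of a bounded sequence are bounded,
  so by Tychonoff's theorem there is a filter on the indices, finer than the one of convergence
  at infinity, along which the means of all bounded sequences converge simultaneously
  (\<open>ex_filter_pointwise_convergent\<close>). The limit along this filter is linear and monotone in the
  sequence, and it is the ordinary limit of the means whenever that exists.

  Two facts about the means give the required properties. First, altering a bounded sequence on a
  set of density zero does not change its means asymptotically, and likewise a bounded sequence
  with statistical limit \<open>l\<close> has means tending to \<open>l\<close> (\<open>cesaro_tendsto_stat_limit\<close>). Hence the
  functional extends the statistical limit; for positivity the exceptional negative terms may be
  replaced by zero, and for invariance a map agreeing almost everywhere with the shift may be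
  replaced by the shift. Secondly, the sums defining the means of \<open>x\<close> and of its shift differ
  only in their end terms, so their means differ by \<open>O(1/n)\<close> (\<open>cesaro_shift\<close>). As to the operator
  norm, the means are bounded by the norm of the sequence, and the constant sequence \<open>1\<close> attains
  this bound.
\<close>

section \<open>Simultaneous convergence along a finer filter\<close>

text \<open>
  By Tychonoff the box of functions bounded pointwise by \<open>M\<close> is compact for pointwise
  convergence, so \<open>A\<close> clusters in it at some \<open>L\<close>. The finer filter is generated by \<open>D\<close> together
  with the preimages of the neighbourhoods of \<open>L\<close>.
\<close>

lemma ex_filter_pointwise_convergent:
  fixes A :: "'i \<Rightarrow> 'a \<Rightarrow> real"
  assumes bound: "\<And>i x. \<bar>A i x\<bar> \<le> M x" and D: "D \<noteq> bot"
  obtains W L where "W \<noteq> bot" "W \<le> D" "\<And>x. ((\<lambda>i. A i x) \<longlongrightarrow> L x) W"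
proof -
  define K where "K = (\<Pi>\<^sub>E x\<in>UNIV. {- M x..M x})"
  have "compactin (product_topology (\<lambda>x::'a. euclidean :: real topology) UNIV) K"
    unfolding K_def by (subst compactin_PiE) auto
  then have "compact K"
    by (simp add: euclidean_product_topology)
  moreover have "A i \<in> K" for i
    using bound[of i] by (auto simp: K_def abs_le_iff minus_le_iff)
  then have "eventually (\<lambda>f. f \<in> K) (filtermap A D)"
    by (simp add: eventually_filtermap)
  moreover have "filtermap A D \<noteq> bot"
    using D by (simp add: filtermap_bot_iff)
  ultimately obtain L where L: "inf (nhds L) (filtermap A D) \<noteq> bot"
    unfolding compact_filter by blast
  define W where "W = inf (filtercomap A (nhds L)) D"
  have "W \<noteq> bot"
  proof
    assume "W = bot"
    then have "eventually (\<lambda>_. False) W" by simp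
    then obtain P Q where P: "eventually P (nhds L)" and Q: "eventually Q D"
      and PQ: "\<And>i. P (A i) \<Longrightarrow> Q i \<Longrightarrow> False"
      unfolding W_def eventually_inf eventually_filtercomap by blast
    have "eventually (\<lambda>f. \<not> P f) (filtermap A D)"
      unfolding eventually_filtermap using Q by (rule eventually_mono) (use PQ in blast)
    with P have "eventually (\<lambda>_. False) (inf (nhds L) (filtermap A D))"
      unfolding eventually_inf by blast
    with L show False by (simp add: eventually_False)
  qed
  moreover have "W \<le> D" by (simp add: W_def)
  moreover have "((\<lambda>i. A i x) \<longlongrightarrow> L x) W" for x
  proof -
    have "filterlim A (nhds L) W"
      unfolding W_def by (rule filterlim_mono[OF filterlim_filtercomap order_refl]) simp
    then show ?thesis
      by (rule continuous_on_tendsto_compose[OF continuous_on_product_coordinates]) auto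
  qed
  ultimately show ?thesis using that by blast
qed

section \<open>Density zero and Cesaro means\<close>

definition cesaro :: "(nat \<Rightarrow> real) \<Rightarrow> nat \<Rightarrow> real" where
  "cesaro p n = (\<Sum>k=1..n. p k) / real n"

lemma cesaro_add: "cesaro (\<lambda>k. p k + q k) n = cesaro p n + cesaro q n"
  by (simp add: cesaro_def sum.distrib add_divide_distrib)

lemma cesaro_diff: "cesaro (\<lambda>k. p k - q k) n = cesaro p n - cesaro q n"
  by (simp add: cesaro_def sum_subtractf diff_divide_distrib)

lemma cesaro_cmult: "cesaro (\<lambda>k. c * p k) n = c * cesaro p n"
  by (simp add: cesaro_def sum_distrib_left)

lemma cesaro_mono: "(\<And>k. p k \<le> q k) \<Longrightarrow> cesaro p n \<le> cesaro q n"
  unfolding cesaro_def by (intro divide_right_mono sum_mono) auto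

lemma cesaro_const: "n \<noteq> 0 \<Longrightarrow> cesaro (\<lambda>_. c) n = c"
  by (simp add: cesaro_def)

lemma cesaro_abs_le:
  assumes "\<And>k. \<bar>p k\<bar> \<le> B"
  shows "\<bar>cesaro p n\<bar> \<le> B"
proof (cases "n = 0")
  case True
  then show ?thesis using order_trans[OF abs_ge_zero assms] by (simp add: cesaro_def)
next
  case False
  have "cesaro p n \<le> cesaro (\<lambda>_. B) n" "cesaro (\<lambda>_. - B) n \<le> cesaro p n"
    using assms by (auto intro!: cesaro_mono simp: abs_le_iff minus_le_iff)
  with False show ?thesis by (simp add: cesaro_const abs_le_iff)
qed

lemma has_natural_density_0_subset:
  assumes "has_natural_density Q 0" "P \<subseteq> Q"
  shows "has_natural_density P 0"
  unfolding has_natural_density_def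
proof (rule tendsto_sandwich[where f = "\<lambda>_. 0"])
  show "(\<lambda>n. real (card (Q \<inter> {1..n})) / real n) \<longlonglongrightarrow> 0"
    using assms(1) by (simp add: has_natural_density_def)
  show "\<forall>\<^sub>F n in sequentially. real (card (P \<inter> {1..n})) / real n \<le> real (card (Q \<inter> {1..n})) / real n"
    using assms(2) by (intro always_eventually allI divide_right_mono) (auto intro!: card_mono)
qed auto

lemma stat_converges_to_0I:
  assumes "almost_all (\<lambda>k. p k = 0)"
  shows "stat_converges_to p 0"
  using assms unfolding stat_converges_to_def almost_all_def
  by (auto elim!: has_natural_density_0_subset)

text \<open>
  A tolerance \<open>e\<close> splits \<open>\<bar>p k - l\<bar>\<close> into at most \<open>e\<close> off the exceptional set \<open>E\<close> and at
  most a constant on \<open>E\<close>; the second part contributes a multiple of the density of \<open>E\<close> to the mean.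
\<close>

lemma cesaro_tendsto_stat_limit:
  assumes bound: "\<And>k. \<bar>p k\<bar> \<le> B" and stat: "stat_converges_to p l"
  shows "cesaro p \<longlonglongrightarrow> l"
proof (rule tendstoI)
  fix e :: real assume e: "e > 0"
  define E where "E = {k. 1 \<le> k \<and> \<bar>p k - l\<bar> > e / 2}"
  define C where "C = B + \<bar>l\<bar>"
  define d where "d n = real (card (E \<inter> {1..n})) / real n" for n
  have C: "\<bar>p k - l\<bar> \<le> C" for k
    using bound[of k] by (simp add: C_def abs_le_iff minus_le_iff abs_if split: if_splits)
  then have "C \<ge> 0" by (rule order_trans[OF abs_ge_zero])
  have "d \<longlonglongrightarrow> 0"
    using stat[unfolded stat_converges_to_def, rule_format, OF half_gt_zero[OF e]]
    by (simp only: has_natural_density_def d_def[abs_def] E_def)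
  then have "(\<lambda>n. e / 2 + C * d n) \<longlonglongrightarrow> e / 2 + C * 0"
    by (intro tendsto_intros)
  then have "\<forall>\<^sub>F n in sequentially. e / 2 + C * d n < e"
    by (rule order_tendstoD) (use e in simp)
  moreover have "\<forall>\<^sub>F n in sequentially. n \<noteq> (0::nat)"
    using eventually_gt_at_top[of "0::nat"] by (rule eventually_mono) simp
  ultimately show "\<forall>\<^sub>F n in sequentially. dist (cesaro p n) l < e"
  proof eventually_elim
    case (elim n)
    have "\<bar>cesaro p n - l\<bar> = \<bar>cesaro (\<lambda>k. p k - l) n\<bar>"
      using elim by (simp add: cesaro_diff cesaro_const)
    also have "\<dots> \<le> (\<Sum>k=1..n. \<bar>p k - l\<bar>) / n"
      unfolding cesaro_def by (simp add: divide_right_mono)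
    also have "\<dots> \<le> (\<Sum>k=1..n. e / 2 + C * indicator E k) / n"
      using e C \<open>C \<ge> 0\<close>
      by (intro divide_right_mono sum_mono) (auto simp: E_def indicator_def intro: add_increasing)
    also have "\<dots> = e / 2 + C * d n"
      using elim
      by (simp add: d_def sum.distrib sum_distrib_left[symmetric] sum.inter_restrict[symmetric]
          indicator_def add_divide_distrib Int_commute)
    finally show ?case using elim by (simp add: dist_real_def)
  qed
qed

section \<open>Cesaro means of bounded sequences\<close>

lemma abs_seq_term_le_norm: "\<bar>seq_term x k\<bar> \<le> norm x"
  using norm_bounded[of x "k - 1"] by (simp add: seq_term_def)

text \<open>
  The minima of the terms with zero vanish almost everywhere, so their means tend to zero, and
  they bound the means of \<open>s\<close> from below.
\<close>

lemma eventually_cesaro_ge_of_almost_all_nonneg: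
  assumes "almost_all (\<lambda>k. seq_term s k \<ge> 0)" "c < 0"
  shows "\<forall>\<^sub>F n in sequentially. c \<le> cesaro (seq_term s) n"
proof -
  define q where "q k = min (seq_term s k) 0" for k
  have "q k = 0 \<longleftrightarrow> seq_term s k \<ge> 0" for k
    by (auto simp: q_def min_def)
  with assms(1) have "almost_all (\<lambda>k. q k = 0)"
    by simp
  moreover have "\<bar>q k\<bar> \<le> norm s" for k
    using abs_seq_term_le_norm[of s k] by (auto simp: q_def min_def)
  ultimately have "cesaro q \<longlonglongrightarrow> 0"
    by (intro cesaro_tendsto_stat_limit stat_converges_to_0I)
  then have "\<forall>\<^sub>F n in sequentially. c < cesaro q n"
    using assms(2) by (rule order_tendstoD)
  moreover have "cesaro q n \<le> cesaro (seq_term s) n" for n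
    by (rule cesaro_mono) (simp add: q_def)
  ultimately show ?thesis
    by (meson eventually_mono less_imp_le order_trans)
qed

lemma cesaro_almost_all_eq:
  assumes "almost_all (\<lambda>k. seq_term x k = seq_term y k)"
  shows "(\<lambda>n. cesaro (seq_term x) n - cesaro (seq_term y) n) \<longlonglongrightarrow> 0"
proof -
  have "\<bar>seq_term x k - seq_term y k\<bar> \<le> norm x + norm y" for k
    using abs_seq_term_le_norm[of x k] abs_seq_term_le_norm[of y k] by linarith
  moreover have "almost_all (\<lambda>k. seq_term x k - seq_term y k = 0)"
    using assms by simp
  ultimately have "cesaro (\<lambda>k. seq_term x k - seq_term y k) \<longlonglongrightarrow> 0"
    by (intro cesaro_tendsto_stat_limit stat_converges_to_0I)
  then show ?thesis by (simp add: cesaro_diff[abs_def])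
qed

text \<open>
  The sums telescope to the difference of two end terms, which is at most \<open>2 * norm x\<close>.
\<close>

lemma cesaro_shift:
  "(\<lambda>n. cesaro (seq_term (shift x)) n - cesaro (seq_term x) n) \<longlonglongrightarrow> 0"
proof (rule Lim_null_comparison)
  have eq: "cesaro (seq_term (shift x)) n - cesaro (seq_term x) n
      = (seq_term x (n + 1) - seq_term x 1) / n" for n
  proof -
    have "(\<Sum>k=1..n. seq_term (shift x) k) - (\<Sum>k=1..n. seq_term x k)
        = (\<Sum>k=1..n. seq_term x (Suc k) - seq_term x k)"
      by (simp add: sum_subtractf seq_term_shift)
    also have "\<dots> = seq_term x (n + 1) - seq_term x 1"
      by (simp add: sum_Suc_diff)
    finally show ?thesis by (simp only: cesaro_def diff_divide_distrib[symmetric])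
  qed
  show "\<forall>\<^sub>F n in sequentially. norm (cesaro (seq_term (shift x)) n - cesaro (seq_term x) n)
      \<le> 2 * norm x / real n"
  proof (intro always_eventually allI)
    fix n
    have "\<bar>seq_term x (n + 1) - seq_term x 1\<bar> \<le> 2 * norm x"
      using abs_seq_term_le_norm[of x "n + 1"] abs_seq_term_le_norm[of x 1] by linarith
    then show "norm (cesaro (seq_term (shift x)) n - cesaro (seq_term x) n) \<le> 2 * norm x / real n"
      unfolding eq by (simp add: divide_right_mono)
  qed
  show "(\<lambda>n. 2 * norm x / real n) \<longlonglongrightarrow> 0"
    by (rule lim_const_over_n)
qed

section \<open>The functional\<close>

theorem theorem3p2:
  shows "\<exists>F :: linf \<Rightarrow> real.
      linear F \<and>
      (bounded_linear F \<and> onorm F = 1) \<and>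
      (\<forall>x\<in>st. F x = stat_lim x) \<and>
      (\<forall>s. almost_all (\<lambda>n. seq_term s n \<ge> 0) \<longrightarrow> F s \<ge> 0) \<and>
      (\<forall>x. \<forall>T :: linf \<Rightarrow> linf.
         (\<forall>y. almost_all (\<lambda>k. seq_term (T y) k = seq_term (shift y) k)) \<longrightarrow>
         F x = F (T x))"
proof -
  obtain W and F :: "linf \<Rightarrow> real" where W: "W \<noteq> bot" "W \<le> sequentially"
    and lim: "\<And>x. ((\<lambda>n. cesaro (seq_term x) n) \<longlongrightarrow> F x) W"
    by (rule ex_filter_pointwise_convergent[of "\<lambda>n x. cesaro (seq_term x) n" norm sequentially])
      (auto intro: cesaro_abs_le abs_seq_term_le_norm)
  have unique: "F x = l" if "((\<lambda>n. cesaro (seq_term x) n) \<longlongrightarrow> l) W" for x l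
    using tendsto_unique[OF W(1) lim that] .
  have coarse: "(f \<longlongrightarrow> l) W" if "f \<longlonglongrightarrow> l" for f and l :: real
    using tendsto_mono[OF W(2) that] .

  have lin: "linear F"
  proof (rule linearI)
    fix x y :: linf
    have "seq_term (x + y) = (\<lambda>k. seq_term x k + seq_term y k)"
      by (simp add: seq_term_def fun_eq_iff)
    then show "F (x + y) = F x + F y"
      using tendsto_add[OF lim[of x] lim[of y]] by (intro unique) (simp add: cesaro_add)
  next
    fix c and x :: linf
    have "seq_term (c *\<^sub>R x) = (\<lambda>k. c * seq_term x k)"
      by (simp add: seq_term_def fun_eq_iff)
    then show "F (c *\<^sub>R x) = c *\<^sub>R F x"
      using tendsto_mult_left[OF lim[of x]] by (intro unique) (simp add: cesaro_cmult)
  qed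

  have le: "\<bar>F x\<bar> \<le> norm x" for x
    using W(1) tendsto_rabs[OF lim]
    by (rule tendsto_upperbound[rotated 2])
      (auto intro!: always_eventually cesaro_abs_le abs_seq_term_le_norm)
  have bl: "bounded_linear F"
    using lin le by (intro bounded_linear.intro bounded_linear_axioms.intro exI[of _ 1]) auto
  have stat: "F x = l" if "stat_converges_to (seq_term x) l" for x l
    using cesaro_tendsto_stat_limit[OF abs_seq_term_le_norm that] by (intro unique coarse)

  have norm: "onorm F = 1"
  proof (rule antisym)
    show "onorm F \<le> 1"
      by (rule onorm_bound) (use le in simp_all)
    define u :: linf where "u = const_bcontfun 1"
    have u: "seq_term u = (\<lambda>_. 1)"
      by (simp add: u_def seq_term_def fun_eq_iff)
    have "F u = 1"
      by (rule stat) (simp add: u stat_converges_to_def has_natural_density_def)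
    moreover have "norm u \<le> 1"
      by (rule norm_bound) (simp add: u_def)
    moreover have "norm (F u) \<le> onorm F * norm u"
      by (rule onorm[OF bl])
    moreover have "onorm F * norm u \<le> onorm F * 1"
      using \<open>norm u \<le> 1\<close> onorm_pos_le[OF bl] by (rule mult_left_mono)
    ultimately show "1 \<le> onorm F" by simp
  qed

  have nonneg: "F s \<ge> 0" if "almost_all (\<lambda>n. seq_term s n \<ge> 0)" for s
  proof (rule dense_le)
    fix c :: real
    assume "c < 0"
    with that have "\<forall>\<^sub>F n in W. c \<le> cesaro (seq_term s) n"
      by (intro filter_leD[OF W(2)] eventually_cesaro_ge_of_almost_all_nonneg)
    then show "c \<le> F s"
      using tendsto_lowerbound[OF lim _ W(1)] by blast
  qed

  have shift_inv: "F x = F (T x)"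
    if T: "\<And>y. almost_all (\<lambda>k. seq_term (T y) k = seq_term (shift y) k)" for x T
  proof -
    \<comment> \<open>The first two summands tend to zero in the ordinary sense; the third converges along \<open>W\<close>.\<close>
    have "((\<lambda>n. (cesaro (seq_term (T x)) n - cesaro (seq_term (shift x)) n)
        + (cesaro (seq_term (shift x)) n - cesaro (seq_term x) n)
        + cesaro (seq_term x) n) \<longlongrightarrow> 0 + 0 + F x) W"
      by (intro tendsto_add coarse lim cesaro_almost_all_eq cesaro_shift T)
    then have "F (T x) = F x"
      by (intro unique) simp
    then show ?thesis ..
  qed

  have "\<forall>x\<in>st. F x = stat_lim x"
    using stat stat_lim_eqI by (auto simp: st_def)
  with lin bl norm nonneg shift_inv show ?thesis
    by (intro exI[of _ F]) blast
qed

end
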